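(* Let $A,B$ be connected, non-trivial graphs, and $f:V(A)\to V(B)$ a function. Then a vertex $(a,b)\in V(A\otimes_f B)$ is a separating vertex of $A\otimes_f B$ if and only if one of the following conditions holds: (i) $a$ is a separating vertex of $A$, and there exists a partition $H_1,H_2,\dots,H_n$, $n\geq 2$, of $V(A-a)$ such that: whenever $h_i\in H_i$ and $h'$ lies in the same connected component of $A-a$ as $h_i$, then $h'\in H_i$; and whenever $h_i\in H_i$ and $h_j\in H_j$ with $i\neq j$ are both neighbours of $a$, the vertex $b$ lies on every path in $B$ from $f(h_i)$ to $f(h_j)$; (ii) $b$ is a separating vertex of $B$, and there exists a connected component $J$ of $B-b$ that is disjoint from the set $\{f(a') : aa'\in E(A)\}$; (iii) $f(a')=b$ for every neighbour $a'$ of $a$ in $A$.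
   Context: All graphs are finite and simple. A graph is non-trivial if it has more than one vertex. A separating vertex of a graph $G$ is a vertex whose removal increases the number of connected components. For graphs $A,B$ and a function $f:V(A)\to V(B)$, the Sierpiński product $A\otimes_f B$ is the graph with vertex set $V(A)\times V(B)$ and edge set $\{(a,b_1)(a,b_2): a\in V(A),\ b_1b_2\in E(B)\}\cup\{(a_1,f(a_2))(a_2,f(a_1)) : a_1a_2\in E(A)\}$. *)

theory Defs
  imports "Graph_Theory.Graph_Theory" "HOL-Library.Disjoint_Sets"
begin

text \<open>
  A finite simple graph is a \<^locale>\<open>pair_graph\<close>: a finite, loop-free digraph without parallel
  arcs in which every edge \<open>uv\<close> is represented by both arcs \<open>(u,v)\<close> and \<open>(v,u)\<close>.
\<close>

definition sierpinski_product ::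
  "'a pair_pre_digraph \<Rightarrow> ('a \<Rightarrow> 'b) \<Rightarrow> 'b pair_pre_digraph \<Rightarrow> ('a \<times> 'b) pair_pre_digraph" where
  "sierpinski_product A f B =
    \<lparr> pverts = pverts A \<times> pverts B,
      parcs = {((a, b1), (a, b2)) | a b1 b2. a \<in> pverts A \<and> (b1, b2) \<in> parcs B}
            \<union> {((a1, f a2), (a2, f a1)) | a1 a2. (a1, a2) \<in> parcs A} \<rparr>"

definition connected_components :: "('a, 'b) pre_digraph \<Rightarrow> ('a, 'b) pre_digraph set" where
  "connected_components G = {H. pre_digraph.max_subgraph G Digraph_Component.connected H}"

text \<open>
  The graph without vertices is not \<^const>\<open>Digraph_Component.connected\<close>, so it has no connected components.
\<close>

definition same_component :: "('a, 'b) pre_digraph \<Rightarrow> 'a \<Rightarrow> 'a \<Rightarrow> bool" where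
  "same_component G u v \<longleftrightarrow> (\<exists>C \<in> connected_components G. u \<in> verts C \<and> v \<in> verts C)"

definition separating_vertex :: "('a, 'b) pre_digraph \<Rightarrow> 'a \<Rightarrow> bool" where
  "separating_vertex G v \<longleftrightarrow> v \<in> verts G \<and>
    card (connected_components G) < card (connected_components (pre_digraph.del_vert G v))"

text \<open>
  Paths may have length 0: if \<open>u = v\<close>, then the only path from \<open>u\<close> to \<open>v\<close> is the vertex \<open>u\<close> itself.
\<close>

definition on_every_path :: "('a, 'b) pre_digraph \<Rightarrow> 'a \<Rightarrow> 'a \<Rightarrow> 'a \<Rightarrow> bool" where
  "on_every_path G w u v \<longleftrightarrow>
    (\<forall>p. pre_digraph.apath G u p v \<longrightarrow> w \<in> set (pre_digraph.awalk_verts G u p))"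

lemma pair_graph_sierpinski_product:
  assumes "pair_graph A" "pair_graph B" and f: "f \<in> pverts A \<rightarrow> pverts B"
  shows "pair_graph (sierpinski_product A f B)"
proof -
  interpret A: pair_graph A by fact
  interpret B: pair_graph B by fact
  let ?G = "sierpinski_product A f B"
  have wf: "parcs ?G \<subseteq> pverts ?G \<times> pverts ?G"
    using f by (auto simp: sierpinski_product_def
        dest: A.in_arcsD1 A.in_arcsD2 B.in_arcsD1 B.in_arcsD2)
  have fin: "finite (pverts ?G)"
    using A.pair_finite_verts B.pair_finite_verts by (simp add: sierpinski_product_def)
  show ?thesis
  proof unfold_locales
    show "finite (parcs ?G)"
      using wf fin by (meson finite_SigmaI finite_subset)
    have "(v, u) \<in> parcs ?G" if "(u, v) \<in> parcs ?G" for u v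
      using that A.arcs_symmetric B.arcs_symmetric unfolding sierpinski_product_def by fastforce
    then show "symmetric (with_proj ?G)"
      by (simp add: symmetric_def sym_def)
    show "fst e \<noteq> snd e" if "e \<in> parcs ?G" for e
      using that A.no_loops' B.no_loops' unfolding sierpinski_product_def by fastforce
    show "fst e \<in> pverts ?G" "snd e \<in> pverts ?G" if "e \<in> parcs ?G" for e
      using that wf by (auto simp: mem_Times_iff)
  qed (fact fin)
qed

end

theory Submission
  imports Defs
begin

text \<open>
  The product is connected, so \<open>(a, b)\<close> separates iff some two vertices of \<open>D\<close>, the product without
  \<open>(a, b)\<close>, are not joined in \<open>D\<close>. Every layer \<open>{h} \<times> V(B)\<close> with \<open>h \<noteq> a\<close> survives intact in \<open>D\<close>, and
  adjacent vertices of \<open>A - a\<close> have linked layers. If a component of \<open>D\<close> stays inside the layer of \<open>a\<close>,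
  it contains a component of \<open>B - b\<close> that avoids \<open>f a'\<close> for all neighbours \<open>a'\<close> of \<open>a\<close>; this is (ii), or (iii) when
  \<open>b\<close> does not separate \<open>B\<close>. Otherwise every component of \<open>D\<close> is a union of layers together with
  part of the layer of \<open>a\<close>, and the layers inside and outside one component give the partition in (i).
  Conversely, each condition yields a set of vertices of \<open>D\<close> closed under adjacency.
\<close>

section \<open>Symmetric digraphs: vertex deletion and reachability\<close>

lemma in_arcs_ends_del_vert:
  "(x, y) \<in> arcs_ends (pre_digraph.del_vert G v) \<longleftrightarrow> (x, y) \<in> arcs_ends G \<and> x \<noteq> v \<and> y \<noteq> v"
  by (auto simp: arcs_ends_conv pre_digraph.del_vert_simps)

lemma (in sym_digraph) sym_digraph_del_vert: "sym_digraph (del_vert v)"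
proof (rule wf_digraph.sym_digraphI[OF wf_digraph_del_vert])
  show "symmetric (del_vert v)"
    using sym_arcs by (auto simp: symmetric_def sym_def in_arcs_ends_del_vert)
qed

text \<open>The source of all non-reachability proofs: a set closed under arcs that contains
  \<open>u\<close> and misses \<open>v\<close> shows that \<open>v\<close> cannot be reached from
  \<open>u\<close>.\<close>

lemma (in wf_digraph) reachable_in_closed:
  assumes "u \<rightarrow>\<^sup>*\<^bsub>G\<^esub> v" and "u \<in> X"
    and "\<And>x y. x \<rightarrow>\<^bsub>G\<^esub> y \<Longrightarrow> x \<in> X \<Longrightarrow> y \<in> X"
  shows "v \<in> X"
  using assms by induct auto

text \<open>Arcs may go to walks and not only to arcs. This allows one edge of \<open>A\<close> to
  be lifted to a walk through two layers of the product.\<close>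

lemma reachable_hom:
  assumes "wf_digraph G" and "wf_digraph H" and "u \<rightarrow>\<^sup>*\<^bsub>G\<^esub> v"
    and "\<And>x. x \<in> verts G \<Longrightarrow> h x \<in> verts H"
    and "\<And>x y. x \<rightarrow>\<^bsub>G\<^esub> y \<Longrightarrow> h x \<rightarrow>\<^sup>*\<^bsub>H\<^esub> h y"
  shows "h u \<rightarrow>\<^sup>*\<^bsub>H\<^esub> h v"
proof -
  interpret G: wf_digraph G by fact
  interpret H: wf_digraph H by fact
  show ?thesis
    using assms(3)
  proof (induct rule: G.reachable_induct)
    case base
    then show ?case using assms(4) by simp
  next
    case (step x y)
    then show ?case using assms(5) H.reachable_trans by blast
  qed
qed

lemma (in wf_digraph) strongly_connected_imp_connected:
  "strongly_connected G \<Longrightarrow> Digraph_Component.connected G"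
  by (auto simp: Digraph_Component.connected_def strongly_connected_def
      intro: reachable_mk_symmetricI)

text \<open>\<open>connected\<close> speaks of \<open>mk_symmetric H\<close>. A walk there is also
  one in \<open>mk_symmetric G\<close>, and symmetry of \<open>G\<close> makes reachability in
  \<open>mk_symmetric G\<close> the same as in \<open>G\<close>.\<close>

lemma (in sym_digraph) connected_subgraph_reachable:
  assumes "subgraph H G" and "Digraph_Component.connected H" and "u \<in> verts H" and "v \<in> verts H"
  shows "u \<rightarrow>\<^sup>*\<^bsub>G\<^esub> v"
proof -
  interpret M: pair_wf_digraph "mk_symmetric G" ..
  have "u \<rightarrow>\<^sup>*\<^bsub>mk_symmetric H\<^esub> v"
    using assms(2-4) by (auto simp: Digraph_Component.connected_def strongly_connected_def)
  then have "u \<rightarrow>\<^sup>*\<^bsub>mk_symmetric G\<^esub> v"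
    using subgraph_mk_symmetric[OF assms(1)] by (rule M.reachable_mono)
  then show ?thesis
    by (simp only: reachable_mk_symmetric_eq[OF sym_arcs])
qed

section \<open>Components, separating vertices and paths in terms of reachability\<close>

lemma (in sym_digraph) connected_iff_reachable:
  "Digraph_Component.connected G \<longleftrightarrow> verts G \<noteq> {} \<and> (\<forall>u\<in>verts G. \<forall>v\<in>verts G. u \<rightarrow>\<^sup>*\<^bsub>G\<^esub> v)"
proof -
  have "Digraph_Component.connected G \<longleftrightarrow> strongly_connected G"
    using symmetric_connected_imp_strongly_connected[OF sym_arcs] strongly_connected_imp_connected ..
  then show ?thesis by (simp only: strongly_connected_def)
qed

text \<open>The subgraph induced on the reachability class of \<open>u\<close> is connected and
  contains every connected subgraph through \<open>u\<close>, so it is the maximal one.\<close>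

lemma (in sym_digraph) connected_components_eq:
  "connected_components G = (\<lambda>u. G \<restriction> {v. u \<rightarrow>\<^sup>*\<^bsub>G\<^esub> v}) ` verts G"
proof (intro equalityI subsetI)
  let ?C = "\<lambda>u. G \<restriction> {v. u \<rightarrow>\<^sup>*\<^bsub>G\<^esub> v}"
  have C: "subgraph (?C u) G \<and> Digraph_Component.connected (?C u)" if "u \<in> verts G" for u
  proof -
    from induce_reachable_is_in_sccs[OF that]
    have sub: "subgraph (?C u) G" and sc: "strongly_connected (?C u)"
      by (simp_all add: sccs_def induced_subgraph_def)
    have "wf_digraph (?C u)" by (rule wellformed_induce_subgraph)
    then have "Digraph_Component.connected (?C u)"
      using sc by (rule wf_digraph.strongly_connected_imp_connected)
    with sub show ?thesis ..
  qed
  \<comment> \<open>Arcs cause no trouble because \<open>?C u\<close> is induced. Both inclusions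
    rest on this fact: it forces a maximal \<open>H\<close> to equal \<open>?C u\<close>, and it
    forbids a connected proper extension \<open>K\<close> of \<open>?C u\<close>.\<close>
  have sub: "subgraph H (?C u)"
    if H: "subgraph H G" "Digraph_Component.connected H" and u: "u \<in> verts H" for H u
  proof -
    have "verts H \<subseteq> {v. u \<rightarrow>\<^sup>*\<^bsub>G\<^esub> v}"
      using connected_subgraph_reachable[OF H u] by (rule_tac subsetI) simp
    then show ?thesis
      using H(1) wf_digraph.wellformed[of H] wellformed_induce_subgraph
      by (intro subgraphI) (auto simp: subgraph_def compatible_def)
  qed
  {
    fix H assume "H \<in> connected_components G"
    then have H: "max_subgraph Digraph_Component.connected H"
      by (simp add: connected_components_def)
    then have H': "subgraph H G" "Digraph_Component.connected H"
      by (auto simp: max_subgraph_def)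
    then obtain u where u: "u \<in> verts H"
      by (auto simp: Digraph_Component.connected_def strongly_connected_def)
    then have uG: "u \<in> verts G" using subgraph_imp_subverts[OF H'(1)] by (rule_tac subsetD)
    have "?C u = H"
      using H C[OF uG] sub[OF H' u] unfolding max_subgraph_def by metis
    then show "H \<in> ?C ` verts G" using uG by (rule image_eqI[OF sym])
  next
    fix H assume "H \<in> ?C ` verts G"
    then obtain u where u: "u \<in> verts G" and H: "H = ?C u" by blast
    have "max_subgraph Digraph_Component.connected (?C u)"
    proof (rule max_subgraphI)
      show "Digraph_Component.connected (?C u)" "subgraph (?C u) G" using C[OF u] by auto
      fix K assume K: "?C u \<noteq> K" "subgraph (?C u) K" "subgraph K G"
      show "\<not> Digraph_Component.connected K"
      proof
        assume conn: "Digraph_Component.connected K"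
        have "u \<in> verts K" using subgraph_imp_subverts[OF K(2)] u by auto
        then have "subgraph K (?C u)" by (rule sub[OF K(3) conn])
        with K(2) have "?C u = K"
          unfolding subgraph_def compatible_def by (intro pre_digraph.equality equalityI) simp_all
        with K(1) show False ..
      qed
    qed
    then show "H \<in> connected_components G" by (simp add: H connected_components_def)
  }
qed

lemma (in sym_digraph) same_component_iff: "same_component G u v \<longleftrightarrow> u \<rightarrow>\<^sup>*\<^bsub>G\<^esub> v"
proof
  assume "same_component G u v"
  then obtain w where "w \<rightarrow>\<^sup>*\<^bsub>G\<^esub> u" "w \<rightarrow>\<^sup>*\<^bsub>G\<^esub> v"
    by (auto simp: same_component_def connected_components_eq)
  then show "u \<rightarrow>\<^sup>*\<^bsub>G\<^esub> v" using reachable_trans symmetric_reachable' by blast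
next
  assume "u \<rightarrow>\<^sup>*\<^bsub>G\<^esub> v"
  then have "u \<in> verts G" "u \<rightarrow>\<^sup>*\<^bsub>G\<^esub> u" "u \<rightarrow>\<^sup>*\<^bsub>G\<^esub> v"
    by (auto simp: reachable_in_verts)
  then show "same_component G u v"
    by (auto simp: same_component_def connected_components_eq)
qed

lemma (in sym_digraph) card_connected_components_connected:
  assumes "Digraph_Component.connected G"
  shows "card (connected_components G) = 1"
proof -
  note conn = assms[unfolded connected_iff_reachable]
  have ne: "verts G \<noteq> {}" using conn ..
  have r: "\<forall>u\<in>verts G. \<forall>v\<in>verts G. u \<rightarrow>\<^sup>*\<^bsub>G\<^esub> v" using conn ..
  have cls: "{v. u \<rightarrow>\<^sup>*\<^bsub>G\<^esub> v} = verts G" if "u \<in> verts G" for u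
    using bspec[OF r that] reachable_in_verts(2)[of u] by blast
  have "connected_components G = (\<lambda>u. G \<restriction> verts G) ` verts G"
    unfolding connected_components_eq by (rule image_cong) (simp_all only: cls)
  also have "\<dots> = {G \<restriction> verts G}"
    by (simp only: image_constant_conv ne if_False)
  finally have "connected_components G = {G \<restriction> verts G}" .
  then show ?thesis by simp
qed

text \<open>A connected graph has exactly one component, so the number grows iff
  \<open>del_vert v\<close> has two different ones. If no vertex remains there are no components,
  and both sides are false.\<close>

lemma (in sym_digraph) separating_vertex_iff:
  assumes "finite (verts G)" and "Digraph_Component.connected G" and v: "v \<in> verts G"
  shows "separating_vertex G v \<longleftrightarrow>
    (\<exists>x \<in> verts G - {v}. \<exists>y \<in> verts G - {v}. \<not> x \<rightarrow>\<^sup>*\<^bsub>del_vert v\<^esub> y)"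
proof -
  interpret D: sym_digraph "del_vert v" by (rule sym_digraph_del_vert)
  have fin: "finite (connected_components (del_vert v))"
    using assms(1) by (simp add: D.connected_components_eq verts_del_vert)
  have "separating_vertex G v \<longleftrightarrow> 1 < card (connected_components (del_vert v))"
    using v card_connected_components_connected[OF assms(2)] by (simp add: separating_vertex_def)
  also have "\<dots> \<longleftrightarrow> (\<exists>C \<in> connected_components (del_vert v). \<exists>C' \<in> connected_components (del_vert v). C \<noteq> C')"
    using card_le_Suc0_iff_eq[OF fin] by (auto simp: not_le[symmetric])
  also have "\<dots> \<longleftrightarrow> (\<exists>x \<in> verts (del_vert v). \<exists>y \<in> verts (del_vert v). \<not> x \<rightarrow>\<^sup>*\<^bsub>del_vert v\<^esub> y)"
  proof -
    \<comment> \<open>An induced subgraph determines its vertex set, so equal components have equal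
      classes. That \<open>y\<close> is a vertex puts it into its own class.\<close>
    have "del_vert v \<restriction> {z. x \<rightarrow>\<^sup>*\<^bsub>del_vert v\<^esub> z} = del_vert v \<restriction> {z. y \<rightarrow>\<^sup>*\<^bsub>del_vert v\<^esub> z} \<longleftrightarrow> x \<rightarrow>\<^sup>*\<^bsub>del_vert v\<^esub> y"
      if y: "y \<in> verts (del_vert v)" for x y
    proof
      assume "del_vert v \<restriction> {z. x \<rightarrow>\<^sup>*\<^bsub>del_vert v\<^esub> z} = del_vert v \<restriction> {z. y \<rightarrow>\<^sup>*\<^bsub>del_vert v\<^esub> z}"
      then have "{z. x \<rightarrow>\<^sup>*\<^bsub>del_vert v\<^esub> z} = {z. y \<rightarrow>\<^sup>*\<^bsub>del_vert v\<^esub> z}"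
        by (metis induce_subgraph_verts)
      then show "x \<rightarrow>\<^sup>*\<^bsub>del_vert v\<^esub> y" using y by auto
    next
      assume "x \<rightarrow>\<^sup>*\<^bsub>del_vert v\<^esub> y"
      then have "{z. x \<rightarrow>\<^sup>*\<^bsub>del_vert v\<^esub> z} = {z. y \<rightarrow>\<^sup>*\<^bsub>del_vert v\<^esub> z}"
        using D.reachable_trans D.symmetric_reachable' by blast
      then show "del_vert v \<restriction> {z. x \<rightarrow>\<^sup>*\<^bsub>del_vert v\<^esub> z} = del_vert v \<restriction> {z. y \<rightarrow>\<^sup>*\<^bsub>del_vert v\<^esub> z}"
        by simp
    qed
    then show ?thesis by (simp add: D.connected_components_eq)
  qed
  finally show ?thesis by (simp add: verts_del_vert)
qed

text \<open>A path avoiding \<open>w\<close> survives the deletion of \<open>w\<close>, and a path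
  of the deleted graph avoids \<open>w\<close>. The case where \<open>w\<close> is an endpoint is
  included: nothing is reachable from or to a deleted vertex, and every path then meets
  \<open>w\<close>.\<close>

lemma (in wf_digraph) on_every_path_iff:
  "on_every_path G w u v \<longleftrightarrow> \<not> u \<rightarrow>\<^sup>*\<^bsub>del_vert w\<^esub> v"
proof
  interpret D: wf_digraph "del_vert w" by (rule wf_digraph_del_vert)
  {
    assume *: "on_every_path G w u v"
    show "\<not> u \<rightarrow>\<^sup>*\<^bsub>del_vert w\<^esub> v"
    proof
      assume "u \<rightarrow>\<^sup>*\<^bsub>del_vert w\<^esub> v"
      then obtain p where p: "D.apath u p v" using D.reachable_apath by blast
      then have "apath u p v" by (rule subgraph_apath_imp_apath[OF _ subgraph_del_vert])
      then have "w \<in> set (awalk_verts u p)" using * by (simp add: on_every_path_def)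
      \<comment> \<open>The vertices of a walk depend only on \<open>tail\<close> and
        \<open>head\<close>, which deletion leaves unchanged.\<close>
      moreover have "awalk_verts u p = D.awalk_verts u p"
        using compatible_awalk_verts[of G "del_vert w"] by (simp add: compatible_def del_vert_simps)
      moreover have "set (D.awalk_verts u p) \<subseteq> verts (del_vert w)"
        using p D.awalkI_apath by blast
      ultimately show False by (auto simp: verts_del_vert)
    qed
  next
    assume *: "\<not> u \<rightarrow>\<^sup>*\<^bsub>del_vert w\<^esub> v"
    have "w \<in> set (awalk_verts u p)" if "apath u p v" for p
    proof (rule ccontr)
      assume "w \<notin> set (awalk_verts u p)"
      moreover have "awalk u p v" using that by (rule awalkI_apath)
      ultimately have "u \<rightarrow>\<^sup>*\<^bsub>del_vert w\<^esub> v"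
      proof (induction p arbitrary: u)
        case Nil
        then show ?case by (auto simp: awalk_Nil_iff verts_del_vert)
      next
        case (Cons e p)
        then have e: "e \<in> arcs G" "tail G e = u" "awalk (head G e) p v"
          and w: "u \<noteq> w" "w \<notin> set (awalk_verts (head G e) p)"
          by (auto simp: awalk_Cons_iff)
        have "head G e \<noteq> w" using w(2) e(3) by (metis hd_in_awalk_verts(1))
        then have "u \<rightarrow>\<^bsub>del_vert w\<^esub> head G e"
          using e w(1) in_arcs_imp_in_arcs_ends by (auto simp: in_arcs_ends_del_vert)
        then show ?case using Cons.IH[OF w(2) e(3)] D.adj_reachable_trans by blast
      qed
      with * show False by simp
    qed
    then show "on_every_path G w u v" by (simp add: on_every_path_def)
  }
qed

section \<open>Layers of the product and the links between them\<close>

locale connected_sierpinski = A: pair_graph A + B: pair_graph B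
  for A :: "'a pair_pre_digraph" and B :: "'b pair_pre_digraph" +
  fixes f :: "'a \<Rightarrow> 'b" and a :: 'a and b :: 'b
  assumes conn_A: "Digraph_Component.connected (with_proj A)"
    and conn_B: "Digraph_Component.connected (with_proj B)"
    and nontriv_A: "card (pverts A) > 1" and nontriv_B: "card (pverts B) > 1"
    and f_in: "f \<in> pverts A \<rightarrow> pverts B"
    and a_in: "a \<in> pverts A" and b_in: "b \<in> pverts B"
begin

abbreviation "P \<equiv> with_proj (sierpinski_product A f B)"
abbreviation "D \<equiv> pre_digraph.del_vert P (a, b)"
abbreviation "Aa \<equiv> pre_digraph.del_vert (with_proj A) a"
abbreviation "Bb \<equiv> pre_digraph.del_vert (with_proj B) b"

lemma parcs_iff:
  "((u, x), (v, y)) \<in> parcs (sierpinski_product A f B) \<longleftrightarrow>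
    u = v \<and> u \<in> pverts A \<and> (x, y) \<in> parcs B \<or> (u, v) \<in> parcs A \<and> x = f v \<and> y = f u"
  by (auto simp: sierpinski_product_def)

lemma pverts_product: "pverts (sierpinski_product A f B) = pverts A \<times> pverts B"
  by (simp add: sierpinski_product_def)

lemma verts_D: "verts D = pverts A \<times> pverts B - {(a, b)}"
  by (simp add: pverts_product pre_digraph.verts_del_vert)

lemma verts_Aa: "verts Aa = pverts A - {a}"
  by (simp add: pre_digraph.verts_del_vert)

lemma verts_Bb: "verts Bb = pverts B - {b}"
  by (simp add: pre_digraph.verts_del_vert)

lemma pair_graph_P: "pair_graph (sierpinski_product A f B)"
  using pair_graph_sierpinski_product A.pair_graph B.pair_graph f_in .

lemma finite_P: "finite (verts P)"
  by (simp only: with_proj_simps pverts_product finite_SigmaI A.pair_finite_verts B.pair_finite_verts)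

lemma sym_A: "sym_digraph (with_proj A)" by (rule A.sym_digraph_axioms)
lemma sym_B: "sym_digraph (with_proj B)" by (rule B.sym_digraph_axioms)

lemma sym_P: "sym_digraph P"
proof -
  interpret P: pair_graph "sierpinski_product A f B" by (rule pair_graph_P)
  show ?thesis by (rule P.sym_digraph_axioms)
qed

sublocale P: sym_digraph P by (rule sym_P)
sublocale D: sym_digraph D by (rule P.sym_digraph_del_vert)
sublocale Aa: sym_digraph Aa by (rule sym_digraph.sym_digraph_del_vert[OF sym_A])
sublocale Bb: sym_digraph Bb by (rule sym_digraph.sym_digraph_del_vert[OF sym_B])

lemma A_reachable: "u \<in> pverts A \<Longrightarrow> v \<in> pverts A \<Longrightarrow> u \<rightarrow>\<^sup>*\<^bsub>with_proj A\<^esub> v"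
  using conn_A sym_digraph.connected_iff_reachable[OF sym_A] by simp

lemma B_reachable: "u \<in> pverts B \<Longrightarrow> v \<in> pverts B \<Longrightarrow> u \<rightarrow>\<^sup>*\<^bsub>with_proj B\<^esub> v"
  using conn_B sym_digraph.connected_iff_reachable[OF sym_B] by simp

lemma f_verts: "u \<in> pverts A \<Longrightarrow> f u \<in> pverts B"
  using f_in by (rule funcset_mem)

lemma P_layer_reachable:
  assumes "h \<in> pverts A" and "x \<in> pverts B" and "y \<in> pverts B"
  shows "(h, x) \<rightarrow>\<^sup>*\<^bsub>P\<^esub> (h, y)"
proof (rule reachable_hom[where G = "with_proj B" and h = "Pair h"])
  fix u v assume "u \<rightarrow>\<^bsub>with_proj B\<^esub> v"
  then have "(h, u) \<rightarrow>\<^bsub>P\<^esub> (h, v)" using assms(1) by (simp only: parcs_iff with_proj_simps simp_thms)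
  then show "(h, u) \<rightarrow>\<^sup>*\<^bsub>P\<^esub> (h, v)" by (rule P.reachable_adjI)
qed (use assms in \<open>simp_all add: pverts_product B_reachable B.wf_digraph_axioms P.wf_digraph_axioms\<close>)

text \<open>For \<open>h \<noteq> a\<close> the layer is a complete copy of the connected graph
  \<open>B\<close>, untouched by the removal of \<open>(a, b)\<close>.\<close>

lemma D_layer_reachable:
  assumes "h \<in> pverts A" and "h \<noteq> a" and "x \<in> pverts B" and "y \<in> pverts B"
  shows "(h, x) \<rightarrow>\<^sup>*\<^bsub>D\<^esub> (h, y)"
proof (rule reachable_hom[where G = "with_proj B" and h = "Pair h"])
  fix u v assume "u \<rightarrow>\<^bsub>with_proj B\<^esub> v"
  then have "(h, u) \<rightarrow>\<^bsub>D\<^esub> (h, v)"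
    using assms(1,2) by (simp add: in_arcs_ends_del_vert parcs_iff)
  then show "(h, u) \<rightarrow>\<^sup>*\<^bsub>D\<^esub> (h, v)" by (rule D.reachable_adjI)
qed (use assms in \<open>simp_all add: verts_D B_reachable B.wf_digraph_axioms D.wf_digraph_axioms\<close>)

text \<open>In the layer of \<open>a\<close> only a copy of \<open>B - b\<close> is left, so joins
  there come from joins in \<open>Bb\<close>.\<close>

lemma D_base_layer_reachable:
  assumes "x \<rightarrow>\<^sup>*\<^bsub>Bb\<^esub> y"
  shows "(a, x) \<rightarrow>\<^sup>*\<^bsub>D\<^esub> (a, y)"
proof (rule reachable_hom[where G = Bb and h = "Pair a"])
  fix u v assume "u \<rightarrow>\<^bsub>Bb\<^esub> v"
  then have "(a, u) \<rightarrow>\<^bsub>D\<^esub> (a, v)"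
    using a_in by (simp add: in_arcs_ends_del_vert parcs_iff)
  then show "(a, u) \<rightarrow>\<^sup>*\<^bsub>D\<^esub> (a, v)" by (rule D.reachable_adjI)
qed (use assms a_in in \<open>auto simp: verts_D verts_Bb Bb.wf_digraph_axioms D.wf_digraph_axioms\<close>)

lemma connected_P: "Digraph_Component.connected P"
proof -
  \<comment> \<open>An edge \<open>uv\<close> of \<open>A\<close> lifts to a walk in three stages:
    inside the layer of \<open>u\<close> from \<open>f u\<close> to \<open>f v\<close>, over the
    link to \<open>(v, f u)\<close>, and inside the layer of \<open>v\<close> to \<open>f v\<close>.
    The vertex \<open>(u, f u)\<close> serves as representative of its layer.\<close>
  have arc: "(u, f u) \<rightarrow>\<^sup>*\<^bsub>P\<^esub> (v, f v)" if "(u, v) \<in> parcs A" for u v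
  proof -
    have uv: "u \<in> pverts A" "v \<in> pverts A" using that A.in_arcsD1 A.in_arcsD2 by blast+
    have "(u, f u) \<rightarrow>\<^sup>*\<^bsub>P\<^esub> (u, f v)" using uv by (simp only: P_layer_reachable f_verts)
    moreover have "(u, f v) \<rightarrow>\<^bsub>P\<^esub> (v, f u)" using that by (simp only: parcs_iff with_proj_simps simp_thms)
    moreover have "(v, f u) \<rightarrow>\<^sup>*\<^bsub>P\<^esub> (v, f v)" using uv by (simp only: P_layer_reachable f_verts)
    ultimately show ?thesis using P.reachable_adj_trans P.reachable_trans by metis
  qed
  have base: "(u, f u) \<rightarrow>\<^sup>*\<^bsub>P\<^esub> (v, f v)" if "u \<in> pverts A" "v \<in> pverts A" for u v
    by (rule reachable_hom[where G = "with_proj A" and h = "\<lambda>u. (u, f u)"])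
      (use arc that in \<open>simp_all add: pverts_product f_verts A_reachable A.wf_digraph_axioms P.wf_digraph_axioms\<close>)
  have "(u, x) \<rightarrow>\<^sup>*\<^bsub>P\<^esub> (v, y)"
    if "u \<in> pverts A" "x \<in> pverts B" "v \<in> pverts A" "y \<in> pverts B" for u x v y
  proof -
    have "(u, x) \<rightarrow>\<^sup>*\<^bsub>P\<^esub> (u, f u)" "(v, f v) \<rightarrow>\<^sup>*\<^bsub>P\<^esub> (v, y)"
      using that by (simp_all only: P_layer_reachable f_verts)
    then show ?thesis using base[OF that(1,3)] P.reachable_trans by metis
  qed
  then show ?thesis using a_in b_in unfolding P.connected_iff_reachable by (auto simp: pverts_product)
qed

text \<open>The three-stage lift of an edge of \<open>A - a\<close> stays in layers other than that
  of \<open>a\<close>, hence avoids \<open>(a, b)\<close>.\<close>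

lemma D_reachable_of_Aa:
  assumes "u \<rightarrow>\<^sup>*\<^bsub>Aa\<^esub> v"
  shows "(u, f u) \<rightarrow>\<^sup>*\<^bsub>D\<^esub> (v, f v)"
proof (rule reachable_hom[where G = Aa and h = "\<lambda>u. (u, f u)"])
  fix u v assume "u \<rightarrow>\<^bsub>Aa\<^esub> v"
  then have arc: "(u, v) \<in> parcs A" and ne: "u \<noteq> a" "v \<noteq> a"
    by (simp_all add: in_arcs_ends_del_vert)
  have uv: "u \<in> pverts A" "v \<in> pverts A" using arc A.in_arcsD1 A.in_arcsD2 by blast+
  have "(u, f u) \<rightarrow>\<^sup>*\<^bsub>D\<^esub> (u, f v)" using uv ne by (simp add: D_layer_reachable f_verts)
  moreover have "(u, f v) \<rightarrow>\<^bsub>D\<^esub> (v, f u)"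
    using arc ne by (simp add: in_arcs_ends_del_vert parcs_iff)
  moreover have "(v, f u) \<rightarrow>\<^sup>*\<^bsub>D\<^esub> (v, f v)" using uv ne by (simp add: D_layer_reachable f_verts)
  ultimately show "(u, f u) \<rightarrow>\<^sup>*\<^bsub>D\<^esub> (v, f v)" using D.reachable_adj_trans D.reachable_trans by metis
qed (use assms in \<open>simp_all add: verts_D verts_Aa f_verts Aa.wf_digraph_axioms D.wf_digraph_axioms\<close>)

text \<open>The link from the layer of \<open>a\<close> to that of \<open>a'\<close> starts at
  \<open>(a, f a')\<close>; it is lost with \<open>(a, b)\<close> exactly when
  \<open>f a' = b\<close>.\<close>

lemma D_exit_adj:
  assumes "(a, a') \<in> parcs A" and "f a' \<noteq> b"
  shows "(a, f a') \<rightarrow>\<^bsub>D\<^esub> (a', f a)"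
  using assms A.no_loops'[OF assms(1)]
  by (simp add: in_arcs_ends_del_vert parcs_iff)

section \<open>Separation of the product and the three conditions\<close>

lemma separating_P_iff:
  "separating_vertex P (a, b) \<longleftrightarrow> (\<exists>x \<in> verts D. \<exists>y \<in> verts D. \<not> x \<rightarrow>\<^sup>*\<^bsub>D\<^esub> y)"
  using P.separating_vertex_iff[OF finite_P connected_P, of "(a, b)"] a_in b_in
  by (simp only: verts_D with_proj_simps pverts_product mem_Times_iff fst_conv snd_conv simp_thms)

lemma separating_A_iff:
  "separating_vertex (with_proj A) a \<longleftrightarrow> (\<exists>x \<in> verts Aa. \<exists>y \<in> verts Aa. \<not> x \<rightarrow>\<^sup>*\<^bsub>Aa\<^esub> y)"
  using sym_digraph.separating_vertex_iff[OF sym_A _ conn_A, of a] a_in A.pair_finite_verts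
  by (simp only: verts_Aa with_proj_simps simp_thms)

lemma separating_B_iff:
  "separating_vertex (with_proj B) b \<longleftrightarrow> (\<exists>x \<in> verts Bb. \<exists>y \<in> verts Bb. \<not> x \<rightarrow>\<^sup>*\<^bsub>Bb\<^esub> y)"
  using sym_digraph.separating_vertex_iff[OF sym_B _ conn_B, of b] b_in B.pair_finite_verts
  by (simp only: verts_Bb with_proj_simps simp_thms)

text \<open>Here non-triviality enters: \<open>A\<close> supplies a layer other than that of
  \<open>a\<close>, and \<open>B\<close> supplies a vertex that remains in the layer of
  \<open>a\<close>.\<close>

lemma other_vertex_A: obtains a' where "a' \<in> pverts A" "a' \<noteq> a"
  using nontriv_A A.pair_finite_verts by (metis card_le_Suc0_iff_eq One_nat_def not_le a_in)

lemma other_vertex_B: obtains y where "y \<in> pverts B" "y \<noteq> b"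
  using nontriv_B B.pair_finite_verts by (metis card_le_Suc0_iff_eq One_nat_def not_le b_in)

text \<open>\<open>X\<close> is a union of components of \<open>D\<close> as far as its vertices in
  \<open>D\<close> are concerned, with \<open>x\<close> inside and \<open>y\<close> outside. The
  closure condition is phrased with coordinates so that \<open>parcs_iff\<close> applies
  directly.\<close>

lemma separating_PI:
  assumes "x \<in> X" "x \<in> verts D" "y \<in> verts D" "y \<notin> X"
    and "\<And>u s v t. (u, s) \<rightarrow>\<^bsub>P\<^esub> (v, t) \<Longrightarrow> (u, s) \<noteq> (a, b) \<Longrightarrow> (v, t) \<noteq> (a, b) \<Longrightarrow>
      (u, s) \<in> X \<Longrightarrow> (v, t) \<in> X"
  shows "separating_vertex P (a, b)"
proof -
  have "\<not> x \<rightarrow>\<^sup>*\<^bsub>D\<^esub> y"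
  proof
    assume "x \<rightarrow>\<^sup>*\<^bsub>D\<^esub> y"
    then have "y \<in> X" using assms(1)
    proof (rule D.reachable_in_closed)
      fix p q assume "p \<rightarrow>\<^bsub>D\<^esub> q" "p \<in> X"
      then show "q \<in> X"
        using assms(5)[of "fst p" "snd p" "fst q" "snd q"] by (simp add: in_arcs_ends_del_vert)
    qed
    with assms(4) show False ..
  qed
  then show ?thesis using assms(2,3) separating_P_iff by blast
qed

text \<open>The class of \<open>y\<close> in \<open>B - b\<close>, placed in the layer of
  \<open>a\<close>, contains no end of a link and is therefore cut off. This serves both (ii) and
  (iii), since in (iii) every \<open>f a'\<close> is the deleted vertex \<open>b\<close>.\<close>

lemma separating_P_if_block:
  assumes y: "y \<in> pverts B" "y \<noteq> b"
    and nbrs: "\<And>a'. (a, a') \<in> parcs A \<Longrightarrow> \<not> y \<rightarrow>\<^sup>*\<^bsub>Bb\<^esub> f a'"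
  shows "separating_vertex P (a, b)"
proof -
  obtain a' where a': "a' \<in> pverts A" "a' \<noteq> a" by (rule other_vertex_A)
  let ?X = "{a} \<times> {z. y \<rightarrow>\<^sup>*\<^bsub>Bb\<^esub> z}"
  show ?thesis
  proof (rule separating_PI[where x = "(a, y)" and X = ?X and y = "(a', y)"])
    fix u s v t
    assume arc: "(u, s) \<rightarrow>\<^bsub>P\<^esub> (v, t)" and ne: "(u, s) \<noteq> (a, b)" "(v, t) \<noteq> (a, b)" and X: "(u, s) \<in> ?X"
    have u: "u = a" and s: "y \<rightarrow>\<^sup>*\<^bsub>Bb\<^esub> s" using X by simp_all
    have "\<not> ((u, v) \<in> parcs A \<and> s = f v)" using nbrs u s by blast
    then have "v = a" and "(s, t) \<in> parcs B" using arc u unfolding with_proj_simps parcs_iff by blast+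
    moreover have "s \<rightarrow>\<^bsub>Bb\<^esub> t" using calculation ne u by (simp add: in_arcs_ends_del_vert)
    ultimately show "(v, t) \<in> ?X" using Bb.reachable_adj_trans[OF s] by simp
  qed (use y a' a_in in \<open>simp_all add: verts_D verts_Bb\<close>)
qed

text \<open>If \<open>y\<close> reached some \<open>f a'\<close> in \<open>B - b\<close>, the link
  there would lead out of the layer of \<open>a\<close>. So the class of \<open>y\<close> is the
  component required in (ii) when \<open>b\<close> separates \<open>B\<close>. When it does not,
  \<open>B - b\<close> is connected and any \<open>f a' \<noteq> b\<close> would be reached, which
  leaves (iii).\<close>

lemma block_if_class_in_base_layer:
  assumes y: "y \<in> pverts B" "y \<noteq> b"
    and cls: "\<And>h z. (a, y) \<rightarrow>\<^sup>*\<^bsub>D\<^esub> (h, z) \<Longrightarrow> h = a"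
  shows "(separating_vertex (with_proj B) b \<and>
        (\<exists>J \<in> connected_components Bb. verts J \<inter> {f a' | a'. (a, a') \<in> parcs A} = {}))
    \<or> (\<forall>a'. (a, a') \<in> parcs A \<longrightarrow> f a' = b)"
proof -
  have nbrs: "\<not> y \<rightarrow>\<^sup>*\<^bsub>Bb\<^esub> f a'" if arc: "(a, a') \<in> parcs A" for a'
  proof
    assume r: "y \<rightarrow>\<^sup>*\<^bsub>Bb\<^esub> f a'"
    then have "f a' \<noteq> b" using Bb.reachable_in_verts(2) verts_Bb by blast
    then have "(a, y) \<rightarrow>\<^sup>*\<^bsub>D\<^esub> (a', f a)"
      using D.reachable_adj_trans[OF D_base_layer_reachable[OF r]] D_exit_adj[OF arc] by blast
    then have "a' = a" by (rule cls)
    then show False using A.no_loops'[OF arc] by simp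
  qed
  show ?thesis
  proof (cases "separating_vertex (with_proj B) b")
    case True
    let ?J = "Bb \<restriction> {z. y \<rightarrow>\<^sup>*\<^bsub>Bb\<^esub> z}"
    have "y \<in> verts Bb" using y by (simp add: verts_Bb)
    then have "?J \<in> connected_components Bb" unfolding Bb.connected_components_eq by (rule imageI)
    moreover have "verts ?J \<inter> {f a' | a'. (a, a') \<in> parcs A} = {}" using nbrs by auto
    ultimately show ?thesis using True by blast
  next
    case False
    have "f a' = b" if arc: "(a, a') \<in> parcs A" for a'
    proof (rule ccontr)
      assume "f a' \<noteq> b"
      then have "f a' \<in> verts Bb" using f_verts A.in_arcsD2[OF arc] by (simp add: verts_Bb)
      moreover have "y \<in> verts Bb" using y by (simp add: verts_Bb)
      ultimately show False using False nbrs[OF arc] separating_B_iff by blast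
    qed
    then show ?thesis by blast
  qed
qed

text \<open>One block \<open>H\<close> yields the closed set: all layers over \<open>H\<close>
  together with the piece of the layer of \<open>a\<close> attached to them. A layer over a second
  block lies outside.\<close>

lemma separating_P_if_partition:
  assumes part: "partition_on (verts Aa) Q" and card: "card Q \<ge> 2"
    and closed: "\<forall>H \<in> Q. \<forall>h \<in> H. \<forall>h'. same_component Aa h h' \<longrightarrow> h' \<in> H"
    and cut: "\<forall>H \<in> Q. \<forall>H' \<in> Q. H \<noteq> H' \<longrightarrow>
       (\<forall>h \<in> H. \<forall>h' \<in> H'. (a, h) \<in> parcs A \<and> (a, h') \<in> parcs A \<longrightarrow>
          on_every_path (with_proj B) b (f h) (f h'))"
  shows "separating_vertex P (a, b)"
proof -
  have "finite Q" using card by (metis card.infinite not_numeral_le_zero)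
  then obtain H H' where H: "H \<in> Q" "H' \<in> Q" "H \<noteq> H'"
    using card card_le_Suc0_iff_eq[of Q] by fastforce
  then obtain h0 h0' where h0: "h0 \<in> H" "h0' \<in> H'"
    using part by (metis partition_onD3 all_not_in_conv)
  have Q_verts: "h \<in> pverts A \<and> h \<noteq> a" if "h \<in> K" "K \<in> Q" for h K
    using part that unfolding partition_on_def verts_Aa by blast
  have disj: "K = K'" if "h \<in> K" "h \<in> K'" "K \<in> Q" "K' \<in> Q" for h K K'
    using partition_onD2[OF part] that unfolding disjoint_def by blast
  have cover: "\<exists>K \<in> Q. h \<in> K" if "h \<in> pverts A" "h \<noteq> a" for h
    using part that unfolding partition_on_def verts_Aa by blast
  \<comment> \<open>\<open>R\<close> collects what can be reached in \<open>B - b\<close> from the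
    points \<open>f h\<close> at which links from \<open>H\<close> enter the layer of
    \<open>a\<close>.\<close>
  define R where "R = {x. \<exists>h \<in> H. (a, h) \<in> parcs A \<and> f h \<rightarrow>\<^sup>*\<^bsub>Bb\<^esub> x}"
  let ?X = "H \<times> pverts B \<union> {a} \<times> R"
  show ?thesis
  proof (rule separating_PI[where x = "(h0, b)" and X = ?X and y = "(h0', b)"])
    show "(h0, b) \<in> ?X" "(h0, b) \<in> verts D" "(h0', b) \<in> verts D"
      using h0 H Q_verts b_in by (auto simp: verts_D)
    show "(h0', b) \<notin> ?X" using disj H h0 Q_verts by blast
    fix u s v t
    assume arc: "(u, s) \<rightarrow>\<^bsub>P\<^esub> (v, t)" and ne: "(u, s) \<noteq> (a, b)" "(v, t) \<noteq> (a, b)" and X: "(u, s) \<in> ?X"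
    from arc consider
        (layer) "u = v" "u \<in> pverts A" "(s, t) \<in> parcs B"
      | (link) "(u, v) \<in> parcs A" "s = f v" "t = f u"
      unfolding with_proj_simps parcs_iff by blast
    then show "(v, t) \<in> ?X"
    proof cases
      case layer
      show ?thesis
      proof (cases "u = a")
        case True
        then obtain h where h: "h \<in> H" "(a, h) \<in> parcs A" "f h \<rightarrow>\<^sup>*\<^bsub>Bb\<^esub> s"
          using X H Q_verts unfolding R_def by blast
        have "s \<rightarrow>\<^bsub>Bb\<^esub> t" using layer ne True by (simp add: in_arcs_ends_del_vert)
        then have "f h \<rightarrow>\<^sup>*\<^bsub>Bb\<^esub> t" by (rule Bb.reachable_adj_trans[OF h(3)])
        then show ?thesis using h layer True unfolding R_def by blast
      next
        case False
        then show ?thesis using X layer B.in_arcsD2 by blast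
      qed
    next
      case link
      have uv: "u \<in> pverts A" "v \<in> pverts A" "u \<noteq> v"
        using link A.in_arcsD1 A.in_arcsD2 A.no_loops' by blast+
      consider "u = a" | "u \<noteq> a" "v = a" | "u \<noteq> a" "v \<noteq> a" by blast
      then show ?thesis
      proof cases
        case 1
        then obtain h where h: "h \<in> H" "(a, h) \<in> parcs A" "f h \<rightarrow>\<^sup>*\<^bsub>Bb\<^esub> f v"
          using X H Q_verts link unfolding R_def by blast
        obtain K where K: "K \<in> Q" "v \<in> K" using cover uv 1 by blast
        \<comment> \<open>The walk leaves the layer of \<open>a\<close> towards \<open>v\<close>.
          Since \<open>f h\<close> and \<open>f v\<close> are joined in \<open>B - b\<close>, the
          path condition prevents \<open>h\<close> and \<open>v\<close> from lying in different
          blocks.\<close>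
        have "\<not> on_every_path (with_proj B) b (f h) (f v)"
          using h(3) B.on_every_path_iff by blast
        then have "K = H" using cut H(1) K h link(1) 1 by blast
        then show ?thesis using K link uv f_verts by blast
      next
        case 2
        have "u \<in> H" using X 2 by blast
        moreover have "(a, u) \<in> parcs A" using link(1) 2 A.arcs_symmetric by blast
        \<comment> \<open>The walk enters the layer of \<open>a\<close> at \<open>f u\<close>, which
          differs from \<open>b\<close> because \<open>(v, t)\<close> is not the removed
          vertex.\<close>
        moreover have "f u \<rightarrow>\<^sup>*\<^bsub>Bb\<^esub> f u"
          using 2 ne link uv f_verts by (simp add: verts_Bb)
        ultimately show ?thesis using 2 link(3) unfolding R_def by blast
      next
        case 3
        have "u \<in> H" using X 3 by blast
        moreover have "u \<rightarrow>\<^bsub>Aa\<^esub> v" using link 3 by (simp add: in_arcs_ends_del_vert)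
        ultimately have "v \<in> H"
          using closed H(1) Aa.same_component_iff Aa.reachable_adjI by blast
        then show ?thesis using link uv f_verts by blast
      qed
    qed
  qed
qed

text \<open>Two blocks suffice: \<open>H1\<close> consists of the vertices whose layers lie in the
  same component of \<open>D\<close> as the layer of \<open>h1\<close>, and \<open>H2\<close> of the
  others.\<close>

lemma partition_if_classes_leave_base_layer:
  assumes h12: "h1 \<in> verts Aa" "h2 \<in> verts Aa" "\<not> (h1, f h1) \<rightarrow>\<^sup>*\<^bsub>D\<^esub> (h2, f h2)"
  shows "separating_vertex (with_proj A) a \<and>
    (\<exists>Q. partition_on (verts Aa) Q \<and> card Q \<ge> 2 \<and>
      (\<forall>H \<in> Q. \<forall>h \<in> H. \<forall>h'. same_component Aa h h' \<longrightarrow> h' \<in> H) \<and>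
      (\<forall>H \<in> Q. \<forall>H' \<in> Q. H \<noteq> H' \<longrightarrow>
         (\<forall>h \<in> H. \<forall>h' \<in> H'. (a, h) \<in> parcs A \<and> (a, h') \<in> parcs A \<longrightarrow>
            on_every_path (with_proj B) b (f h) (f h'))))"
proof
  show "separating_vertex (with_proj A) a"
    \<comment> \<open>A walk from \<open>h1\<close> to \<open>h2\<close> in \<open>A - a\<close>
      would lift to one between their layers in \<open>D\<close>.\<close>
    using h12 D_reachable_of_Aa separating_A_iff by blast
  define H1 where "H1 = {h \<in> verts Aa. (h1, f h1) \<rightarrow>\<^sup>*\<^bsub>D\<^esub> (h, f h)}"
  define H2 where "H2 = verts Aa - H1"
  have in1: "h1 \<in> H1" using h12(1) by (simp add: H1_def verts_D verts_Aa f_verts)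
  have in2: "h2 \<in> H2" using h12 by (simp add: H1_def H2_def)
  have ne: "H1 \<noteq> H2" using in1 by (auto simp: H2_def)
  have closed: "h \<in> H1 \<longleftrightarrow> h' \<in> H1"
    if "h \<in> verts Aa" "h' \<in> verts Aa" "(h, f h) \<rightarrow>\<^sup>*\<^bsub>D\<^esub> (h', f h')" for h h'
    using that D.reachable_trans D.symmetric_reachable' unfolding H1_def by blast
  have cut: "on_every_path (with_proj B) b (f h) (f h')"
    if h: "h \<in> verts Aa" "h' \<in> verts Aa" "(a, h) \<in> parcs A" "(a, h') \<in> parcs A"
      and sep: "(h \<in> H1) \<noteq> (h' \<in> H1)" for h h'
  proof (rule ccontr)
    assume "\<not> ?thesis"
    \<comment> \<open>A path from \<open>f h\<close> to \<open>f h'\<close> avoiding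
      \<open>b\<close> can be walked inside the layer of \<open>a\<close>. Both its ends differ from
      \<open>b\<close>, so the links to the layers of \<open>h\<close> and \<open>h'\<close> survive
      and join these layers, although \<open>H1\<close> separates them.\<close>
    then have r: "f h \<rightarrow>\<^sup>*\<^bsub>Bb\<^esub> f h'" using B.on_every_path_iff by blast
    then have nb: "f h \<noteq> b" "f h' \<noteq> b" using Bb.reachable_in_verts verts_Bb by blast+
    have hA: "h \<in> pverts A" "h' \<in> pverts A" "h \<noteq> a" "h' \<noteq> a"
      using h by (simp_all add: verts_Aa)
    have exit: "(k, f k) \<rightarrow>\<^sup>*\<^bsub>D\<^esub> (a, f k)"
      if k: "(a, k) \<in> parcs A" "f k \<noteq> b" "k \<in> pverts A" "k \<noteq> a" for k
    proof -
      have "(a, f k) \<rightarrow>\<^sup>*\<^bsub>D\<^esub> (k, f a)" by (rule D.reachable_adjI[OF D_exit_adj[OF k(1,2)]])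
      moreover have "(k, f a) \<rightarrow>\<^sup>*\<^bsub>D\<^esub> (k, f k)"
        using k a_in by (simp add: D_layer_reachable f_verts)
      ultimately show ?thesis using D.reachable_trans D.symmetric_reachable' by metis
    qed
    have "(h, f h) \<rightarrow>\<^sup>*\<^bsub>D\<^esub> (a, f h)" using exit h(3) nb(1) hA(1,3) by blast
    moreover have "(a, f h) \<rightarrow>\<^sup>*\<^bsub>D\<^esub> (a, f h')" using r by (rule D_base_layer_reachable)
    moreover have "(a, f h') \<rightarrow>\<^sup>*\<^bsub>D\<^esub> (h', f h')"
      using exit h(4) nb(2) hA(2,4) D.symmetric_reachable' by blast
    ultimately have "(h, f h) \<rightarrow>\<^sup>*\<^bsub>D\<^esub> (h', f h')" using D.reachable_trans by metis
    then show False using closed h(1,2) sep by blast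
  qed
  have part: "partition_on (verts Aa) {H1, H2}"
    using in1 in2 unfolding partition_on_def disjoint_def H2_def H1_def by blast
  have card: "card {H1, H2} \<ge> 2" using ne by simp
  have comps: "h' \<in> H" if "H \<in> {H1, H2}" "h \<in> H" "same_component Aa h h'" for H h h'
  proof -
    have r: "h \<rightarrow>\<^sup>*\<^bsub>Aa\<^esub> h'" using that(3) Aa.same_component_iff by blast
    then have v: "h \<in> verts Aa" "h' \<in> verts Aa" by (rule Aa.reachable_in_verts)+
    then have "h \<in> H1 \<longleftrightarrow> h' \<in> H1" using closed D_reachable_of_Aa[OF r] by blast
    then show ?thesis using that(1,2) v unfolding H2_def by blast
  qed
  have paths: "on_every_path (with_proj B) b (f h) (f h')"
    if "H \<in> {H1, H2}" "H' \<in> {H1, H2}" "H \<noteq> H'" "h \<in> H" "h' \<in> H'"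
      "(a, h) \<in> parcs A \<and> (a, h') \<in> parcs A" for H H' h h'
  proof -
    have "h \<in> verts Aa" "h' \<in> verts Aa" "(h \<in> H1) \<noteq> (h' \<in> H1)"
      using that unfolding H2_def H1_def by blast+
    then show ?thesis using cut that(6) by blast
  qed
  show "\<exists>Q. partition_on (verts Aa) Q \<and> card Q \<ge> 2 \<and>
      (\<forall>H \<in> Q. \<forall>h \<in> H. \<forall>h'. same_component Aa h h' \<longrightarrow> h' \<in> H) \<and>
      (\<forall>H \<in> Q. \<forall>H' \<in> Q. H \<noteq> H' \<longrightarrow>
         (\<forall>h \<in> H. \<forall>h' \<in> H'. (a, h) \<in> parcs A \<and> (a, h') \<in> parcs A \<longrightarrow>
            on_every_path (with_proj B) b (f h) (f h')))"
    by (intro exI[of _ "{H1, H2}"] conjI ballI allI impI) (fact part card comps paths)+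
qed

end

section \<open>The characterization of separating vertices\<close>

theorem theorem1p1:
  fixes A :: "'a pair_pre_digraph" and B :: "'b pair_pre_digraph"
    and f :: "'a \<Rightarrow> 'b" and a :: 'a and b :: 'b
  assumes "pair_graph A" and "Digraph_Component.connected (with_proj A)" and "card (pverts A) > 1"
    and "pair_graph B" and "Digraph_Component.connected (with_proj B)" and "card (pverts B) > 1"
    and "f \<in> pverts A \<rightarrow> pverts B"
    and "(a, b) \<in> pverts (sierpinski_product A f B)"
  shows "separating_vertex (with_proj (sierpinski_product A f B)) (a, b) \<longleftrightarrow>
      (separating_vertex (with_proj A) a \<and>
        (\<exists>P. partition_on (verts (pre_digraph.del_vert (with_proj A) a)) P \<and> card P \<ge> 2 \<and>
          (\<forall>H \<in> P. \<forall>h \<in> H. \<forall>h'.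
             same_component (pre_digraph.del_vert (with_proj A) a) h h' \<longrightarrow> h' \<in> H) \<and>
          (\<forall>H \<in> P. \<forall>H' \<in> P. H \<noteq> H' \<longrightarrow>
             (\<forall>h \<in> H. \<forall>h' \<in> H'. (a, h) \<in> parcs A \<and> (a, h') \<in> parcs A \<longrightarrow>
                on_every_path (with_proj B) b (f h) (f h')))))
    \<or> (separating_vertex (with_proj B) b \<and>
        (\<exists>J \<in> connected_components (pre_digraph.del_vert (with_proj B) b).
           verts J \<inter> {f a' | a'. (a, a') \<in> parcs A} = {}))
    \<or> (\<forall>a'. (a, a') \<in> parcs A \<longrightarrow> f a' = b)"
    (is "?sep \<longleftrightarrow> ?i \<or> ?ii \<or> ?iii")
proof -
  have "a \<in> pverts A" "b \<in> pverts B"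
    using assms(8) by (simp_all add: sierpinski_product_def)
  then interpret connected_sierpinski A B f a b
    using assms(1-7) by (intro connected_sierpinski.intro connected_sierpinski_axioms.intro)
  show ?thesis
  proof
    assume ?sep
    then obtain x y where xy: "x \<in> verts D" "y \<in> verts D" "\<not> x \<rightarrow>\<^sup>*\<^bsub>D\<^esub> y"
      using separating_P_iff by blast
    show "?i \<or> ?ii \<or> ?iii"
    proof (cases "?ii \<or> ?iii")
      case True
      then show ?thesis by (rule disjI2)
    next
      case False
      \<comment> \<open>As (ii) and (iii) fail, no component of \<open>D\<close> stays inside the
        layer of \<open>a\<close>. Hence the unjoined \<open>x\<close> and \<open>y\<close> can be
        replaced by representatives of layers over \<open>A - a\<close>.\<close>
      have leave: "\<exists>h \<in> verts Aa. z \<rightarrow>\<^sup>*\<^bsub>D\<^esub> (h, f h)" if z: "z \<in> verts D" for z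
      proof -
        obtain u s where us: "z = (u, s)" "u \<in> pverts A" "s \<in> pverts B" "u = a \<Longrightarrow> s \<noteq> b"
          using z by (cases z) (auto simp: verts_D)
        have "\<exists>h t. z \<rightarrow>\<^sup>*\<^bsub>D\<^esub> (h, t) \<and> h \<noteq> a"
        proof (cases "u = a")
          case True
          then show ?thesis using block_if_class_in_base_layer[of s] False us by blast
        next
          case False
          then show ?thesis using D.reachable_refl[OF z] us(1) by blast
        qed
        then obtain h t where h: "z \<rightarrow>\<^sup>*\<^bsub>D\<^esub> (h, t)" "h \<noteq> a" by blast
        then have ht: "h \<in> pverts A" "t \<in> pverts B"
          using D.reachable_in_verts(2)[OF h(1)] by (simp_all add: verts_D)
        then have "(h, t) \<rightarrow>\<^sup>*\<^bsub>D\<^esub> (h, f h)" using h(2) by (simp add: D_layer_reachable f_verts)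
        then have "z \<rightarrow>\<^sup>*\<^bsub>D\<^esub> (h, f h)" by (rule D.reachable_trans[OF h(1)])
        moreover have "h \<in> verts Aa" using ht h(2) by (simp add: verts_Aa)
        ultimately show ?thesis by blast
      qed
      obtain h1 where h1: "h1 \<in> verts Aa" "x \<rightarrow>\<^sup>*\<^bsub>D\<^esub> (h1, f h1)" using leave[OF xy(1)] by blast
      obtain h2 where h2: "h2 \<in> verts Aa" "y \<rightarrow>\<^sup>*\<^bsub>D\<^esub> (h2, f h2)" using leave[OF xy(2)] by blast
      have "\<not> (h1, f h1) \<rightarrow>\<^sup>*\<^bsub>D\<^esub> (h2, f h2)"
        using xy(3) h1(2) D.symmetric_reachable'[OF h2(2)] D.reachable_trans by metis
      then show ?thesis
        using partition_if_classes_leave_base_layer[OF h1(1) h2(1)] by (intro disjI1)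
    qed
  next
    assume "?i \<or> ?ii \<or> ?iii"
    then consider ?i | ?ii | ?iii by blast
    then show ?sep
    proof cases
      case 1
      then show ?thesis by (elim conjE exE) (rule separating_P_if_partition)
    next
      case 2
      \<comment> \<open>The component \<open>J\<close> is a reachability class, and \<open>y\<close>
        is the vertex that generates it.\<close>
      then obtain y where y: "y \<in> verts Bb"
        and nbrs: "verts (Bb \<restriction> {z. y \<rightarrow>\<^sup>*\<^bsub>Bb\<^esub> z}) \<inter> {f a' | a'. (a, a') \<in> parcs A} = {}"
        unfolding Bb.connected_components_eq by blast
      show ?thesis
        using y nbrs by (intro separating_P_if_block[of y]) (auto simp: verts_Bb)
    next
      case 3
      obtain y where y: "y \<in> pverts B" "y \<noteq> b" by (rule other_vertex_B)
      \<comment> \<open>Here \<open>f a' = b\<close> is no vertex of \<open>Bb\<close> and so cannot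
        be reached.\<close>
      have "\<not> y \<rightarrow>\<^sup>*\<^bsub>Bb\<^esub> f a'" if "(a, a') \<in> parcs A" for a'
        using 3 that Bb.reachable_in_verts(2) verts_Bb by blast
      then show ?thesis using y by (rule_tac separating_P_if_block)
    qed
  qed
qed

end
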